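(* Let $X$ be a reflexive Banach space and let $Z$ be a Hausdorff topological vector space. Let $C\subseteq Z$ be a convex and pointed cone with nonempty interior, and let $K$ be a nonempty, convex and closed subset of $X$. Consider a mapping $F:K\times K\times K\to Z$ satisfying: (i) for every $y\in K$, one of the following conditions is satisfied with respect to the weak topology of $X$ (that is, convergence of nets in $K$ and neighborhoods of points of $K$ are taken in the weak topology): (a) for every net $(x_\alpha)\subseteq K$ with $\lim x_\alpha=x$: if $F(x_\alpha,y,x_\alpha)\notin-\operatorname{int}C$ for all $\alpha$, then $F(x,y,x)\notin-\operatorname{int}C$; (b) the mapping $x\mapsto F(x,y,x)$ is $C$-upper semicontinuous on $K$; (c) for every $x\in K$ and every net $(x_\alpha)\subseteq K$ with $\lim x_\alpha=x$ there exists a net $(z_\alpha)\subseteq Z$ with $\lim z_\alpha=z$ such that $F(x_\alpha,y,x_\alpha)-z_\alpha\in-C$ and $F(x,y,x)-z\in C$; (ii) for every $x\in K$, the mapping $y\mapsto F(x,y,x)$ is $C$-convex; (iii) for every $x\in K$, $F(x,x,x)\in(-C)\setminus(-\operatorname{int}C)$; (iv) there exists $r>0$ such that, for all $x\in K$ with $\|x\|=r$, there exists $y_0\in K$ with $\|y_0\|<r$ and $F(x,y_0,x)\in-C$. Then there exists an element $x_0\in K$ such that $F(x_0,y,x_0)\notin-\operatorname{int}C$ for all $y\in K$.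
   Context: All spaces are real. A cone $C$ satisfies $tc\in C$ for all $c\in C$, $t\ge 0$; it is convex if $C+C=C$ and pointed if $C\cap(-C)=\{0\}$. $\operatorname{int}C$ is the interior of $C$. A map $f:K\to Z$ is $C$-upper semicontinuous at $x\in K$ if for any neighborhood $V$ of $f(x)$ there exists a neighborhood $U$ of $x$ such that $f(u)\in V-C$ for all $u\in U\cap K$; it is $C$-upper semicontinuous on $K$ if this holds at every $x\in K$. A map $f:K\to Z$ ($K$ convex) is $C$-convex if $tf(x)+(1-t)f(y)-f(tx+(1-t)y)\in C$ for all $x,y\in K$, $t\in[0,1]$.
   Formalization: Condition (iv) additionally requires that K contain a point of norm at most r; without this (iv) can be vacuous and the claim fails, e.g. X=Z=R, C=[0,∞), K=[1,∞), r=1/2, F(x,y,w)=x−y. *)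

theory Defs
  imports "HOL-Analysis.Analysis"
begin

text \<open>Real topological vector spaces; the Hausdorff property is the separate class \<open>t2_space\<close>.\<close>

class topological_real_vector = topological_ab_group_add + real_vector +
  assumes tendsto_scaleR_Pair_nhds:
    "((\<lambda>p::real \<times> 'a. fst p *\<^sub>R snd p) \<longlongrightarrow> t *\<^sub>R a) (nhds t \<times>\<^sub>F nhds a)"

lift_definition bidual_embedding ::
    "'a::real_normed_vector \<Rightarrow> (('a \<Rightarrow>\<^sub>L real) \<Rightarrow>\<^sub>L real)"
  is "\<lambda>x \<phi>. blinfun_apply \<phi> x"
  by (rule blinfun.bounded_linear_left)

definition reflexive_space :: "'a::real_normed_vector itself \<Rightarrow> bool" where
  "reflexive_space _ \<longleftrightarrow> surj (bidual_embedding :: 'a \<Rightarrow> (('a \<Rightarrow>\<^sub>L real) \<Rightarrow>\<^sub>L real))"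

definition weak_topology :: "'a::real_normed_vector topology" where
  "weak_topology = topology_generated_by
     {blinfun_apply \<phi> -` U | (\<phi> :: 'a \<Rightarrow>\<^sub>L real) U. open U}"

text \<open>A net is a function on a nonempty set \<open>D\<close> that is directed by a preorder \<open>le\<close>; its values
  outside \<open>D\<close> are irrelevant. Its convergence is convergence along \<open>net_filter D le\<close>.\<close>

definition directed_set :: "'i set \<Rightarrow> ('i \<Rightarrow> 'i \<Rightarrow> bool) \<Rightarrow> bool" where
  "directed_set D le \<longleftrightarrow> D \<noteq> {} \<and> (\<forall>a\<in>D. le a a) \<and>
     (\<forall>a\<in>D. \<forall>b\<in>D. \<forall>c\<in>D. le a b \<longrightarrow> le b c \<longrightarrow> le a c) \<and>
     (\<forall>a\<in>D. \<forall>b\<in>D. \<exists>c\<in>D. le a c \<and> le b c)"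

definition net_filter :: "'i set \<Rightarrow> ('i \<Rightarrow> 'i \<Rightarrow> bool) \<Rightarrow> 'i filter" where
  "net_filter D le = (INF d\<in>D. principal {e\<in>D. le d e})"

lemma eventually_net_filter:
  assumes "directed_set D le"
  shows "eventually P (net_filter D le) \<longleftrightarrow> (\<exists>d\<in>D. \<forall>e\<in>D. le d e \<longrightarrow> P e)"
proof -
  have "eventually P (net_filter D le) \<longleftrightarrow> (\<exists>d\<in>D. eventually P (principal {e\<in>D. le d e}))"
    unfolding net_filter_def
  proof (rule eventually_INF_base)
    show "D \<noteq> {}" using assms by (simp add: directed_set_def)
    fix a b assume ab: "a \<in> D" "b \<in> D"
    then obtain c where c: "c \<in> D" "le a c" "le b c"
      using assms unfolding directed_set_def by blast
    have "{e\<in>D. le c e} \<subseteq> {e\<in>D. le a e} \<inter> {e\<in>D. le b e}"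
      using assms ab c unfolding directed_set_def by blast
    with c show "\<exists>x\<in>D. principal {e\<in>D. le x e} \<le>
        inf (principal {e\<in>D. le a e}) (principal {e\<in>D. le b e})"
      by auto
  qed
  then show ?thesis by (auto simp: eventually_principal)
qed

text \<open>Quantification over nets cannot range over all index types inside a formula, so nets in a
  space of type \<open>'a\<close> are indexed by subsets of \<open>'a \<times> 'a set\<close>. Every proper filter
  on \<open>'a\<close> is the image of the \<open>net_filter\<close> of such a net: take the pairs \<open>(u, U)\<close> with
  \<open>u \<in> U\<close> and \<open>U\<close> in the filter, ordered by reverse inclusion of the second components. A
  hypothesis on all nets of this form is implied by the same hypothesis on all nets.\<close>

type_synonym 'a net_index = "'a \<times> 'a set"

text \<open>The difference \<open>V - C\<close> of subsets of a vector space is written \<open>V + uminus ` C\<close>, since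
  \<open>-\<close> on sets is set difference and complement. Neighbourhoods need not be open.\<close>

definition cone_usc_on ::
    "'a topology \<Rightarrow> 'z::{topological_space, ab_group_add} set \<Rightarrow> 'a set \<Rightarrow> ('a \<Rightarrow> 'z) \<Rightarrow> bool" where
  "cone_usc_on T C K f \<longleftrightarrow>
     (\<forall>x\<in>K. \<forall>V. f x \<in> interior V \<longrightarrow>
        (\<exists>U. x \<in> T interior_of U \<and> (\<forall>u\<in>U \<inter> K. f u \<in> V + uminus ` C)))"

definition cone_convex_on ::
    "'z::real_vector set \<Rightarrow> 'a::real_vector set \<Rightarrow> ('a \<Rightarrow> 'z) \<Rightarrow> bool" where
  "cone_convex_on C K f \<longleftrightarrow>
     (\<forall>x\<in>K. \<forall>y\<in>K. \<forall>t\<in>{0..1}.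
        t *\<^sub>R f x + (1 - t) *\<^sub>R f y - f (t *\<^sub>R x + (1 - t) *\<^sub>R y) \<in> C)"

end

theory Submission
  imports Defs
begin

text \<open>Write \<open>G y\<close> for the set of \<open>x \<in> K\<close> with \<open>F x y x \<notin> - interior C\<close>. The claim is that the sets \<open>G y\<close>,
  \<open>y \<in> K\<close>, have a common point. The proof is Ky Fan's intersection argument on the part \<open>Kr\<close> of \<open>K\<close> in the
  ball of radius \<open>r\<close>, followed by an extension from \<open>Kr\<close> to \<open>K\<close>.

  \<^item> Each \<open>G y\<close> is weakly closed (\<open>closedin_not_strictly_negative\<close>), and \<open>Kr\<close> is weakly compact, being
    closed, convex and bounded in a reflexive space (\<open>closedin_weak_convex\<close>, \<open>reflexive_compactin_weak\<close>).
    Hence it suffices to intersect finitely many sets \<open>G y\<close> with \<open>Kr\<close>.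

  \<^item> For fixed \<open>x\<close> the set of \<open>y\<close> with \<open>F x y x \<in> - interior C\<close> is convex
    (\<open>convex_strictly_negative_set\<close>) and does not contain \<open>x\<close>. So no \<open>x\<close> in the convex hull of
    points \<open>y\<close> of \<open>Kr\<close> can avoid all their sets \<open>G y\<close>, which is the covering hypothesis of the theorem of
    Knaster, Kuratowski and Mazurkiewicz (\<open>KKM_finite\<close>). It gives the finite intersections, and so a point
    \<open>x0 \<in> Kr\<close> in \<open>G y\<close> for all \<open>y \<in> Kr\<close>.

  \<^item> There is a point \<open>w \<in> K\<close> strictly inside the ball with \<open>F x0 w x0 \<in> - C\<close>. If \<open>F x0 y x0\<close> were in
    \<open>- interior C\<close> for some \<open>y \<in> K\<close>, then by convexity so would be the value at every point of the segment
    from \<open>w\<close> to \<open>y\<close> other than \<open>w\<close>; but those near \<open>w\<close> lie in \<open>Kr\<close>.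

  Separation of a point from a closed convex set rests on the Hahn-Banach theorem, obtained here from
  minimal sublinear functionals. The theorem of Knaster, Kuratowski and Mazurkiewicz rests on Brouwer's fixed
  point theorem in arbitrary finite dimension, obtained from Kuhn's combinatorial lemma.\<close>

section \<open>Sublinear functionals and separation of convex sets\<close>

definition sublinear :: "('a::real_vector \<Rightarrow> real) \<Rightarrow> bool" where
  "sublinear q \<longleftrightarrow> (\<forall>x y. q (x + y) \<le> q x + q y) \<and> (\<forall>x. \<forall>t\<ge>0. q (t *\<^sub>R x) = t * q x)"

lemma sublinear_add: "sublinear q \<Longrightarrow> q (x + y) \<le> q x + q y"
  and sublinear_scale: "sublinear q \<Longrightarrow> 0 \<le> t \<Longrightarrow> q (t *\<^sub>R x) = t * q x"
  by (auto simp: sublinear_def)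

lemma sublinear_zero: "sublinear q \<Longrightarrow> q 0 = 0"
  using sublinear_scale[of q 0 0] by simp

lemma sublinear_minus: "sublinear q \<Longrightarrow> - q (- x) \<le> q x"
  using sublinear_add[of q x "- x"] sublinear_zero[of q] by simp

lemma sublinear_norm: "sublinear norm"
  by (simp add: sublinear_def norm_triangle_ineq)

lemma sublinearI_pos:
  assumes "\<And>x y. q (x + y) \<le> q x + q y" and "q 0 = 0"
    and pos: "\<And>x t. 0 < t \<Longrightarrow> q (t *\<^sub>R x) \<le> t * q x"
  shows "sublinear q"
  unfolding sublinear_def
proof (intro conjI allI impI)
  fix x :: 'a and t :: real assume "0 \<le> t"
  show "q (t *\<^sub>R x) = t * q x"
  proof (cases "t = 0")
    case False
    with \<open>0 \<le> t\<close> have t: "0 < t" by simp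
    have "t * q x = t * q (inverse t *\<^sub>R (t *\<^sub>R x))" using t by simp
    also have "\<dots> \<le> t * (inverse t * q (t *\<^sub>R x))"
      by (intro mult_left_mono pos) (use t in auto)
    also have "\<dots> = q (t *\<^sub>R x)" using t by simp
    finally show ?thesis using pos[OF t, of x] by simp
  qed (use assms(2) in simp)
qed (rule assms(1))

text \<open>The part of \<open>q\<close> lying over the cone spanned by the pairs \<open>(s, d)\<close>, \<open>s \<in> S\<close>, is collapsed:
  \<open>q' z\<close> is the infimum of \<open>q (z + t s) - t d\<close> over \<open>t \<ge> 0\<close> and \<open>s \<in> S\<close>. Convexity of \<open>S\<close> makes these
  pairs a convex cone, hence \<open>q'\<close> subadditive, and the bound \<open>d \<le> q\<close> on \<open>S\<close> keeps the infimum finite.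
  With \<open>S\<close> a single point this shows that minimal sublinear functionals are odd; with \<open>q\<close> the norm
  it turns a positive distance to \<open>S\<close> into a functional that is at least \<open>d\<close> on \<open>S\<close>.\<close>

lemma sublinear_push_below:
  assumes q: "sublinear q" and S: "convex S" "S \<noteq> {}" and d: "\<And>s. s \<in> S \<Longrightarrow> d \<le> q s"
  obtains q' where "sublinear q'" "\<And>x. q' x \<le> q x" "\<And>s. s \<in> S \<Longrightarrow> q' (- s) \<le> - d"
proof -
  define I where "I = {0::real..} \<times> S"
  define h where "h z p = q (z + fst p *\<^sub>R snd p) - fst p * d" for z and p :: "real \<times> 'a"
  define q' where "q' z = (INF p\<in>I. h z p)" for z
  have I: "I \<noteq> {}" using S(2) by (auto simp: I_def)
  have lower: "- q (- z) \<le> h z p" if "p \<in> I" for z p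
  proof -
    obtain t s where p: "p = (t, s)" "0 \<le> t" "s \<in> S" using \<open>p \<in> I\<close> by (auto simp: I_def)
    have "t * d \<le> q (t *\<^sub>R s)" using d[OF p(3)] p(2) sublinear_scale[OF q p(2)] by (simp add: mult_left_mono)
    also have "\<dots> \<le> q (z + t *\<^sub>R s) + q (- z)"
      using sublinear_add[OF q, of "z + t *\<^sub>R s" "- z"] by simp
    finally show ?thesis by (simp add: h_def p(1))
  qed
  have le: "q' z \<le> h z p" if "p \<in> I" for z p
    unfolding q'_def by (rule cINF_lower[OF _ that]) (use lower in \<open>auto intro!: bdd_belowI2\<close>)
  have ge: "c \<le> q' z" if "\<And>p. p \<in> I \<Longrightarrow> c \<le> h z p" for c z
    unfolding q'_def by (rule cINF_greatest[OF I that])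
  have add: "q' (x + y) \<le> q' x + q' y" for x y
  proof -
    have *: "q' (x + y) \<le> h x p + h y p'" if p: "p \<in> I" and p': "p' \<in> I" for p p'
    proof -
      obtain t s t' s' where ps: "p = (t, s)" "0 \<le> t" "s \<in> S" "p' = (t', s')" "0 \<le> t'" "s' \<in> S"
        using p p' by (auto simp: I_def)
      \<comment> \<open>The weighted mean of the two points, or either of them if both weights vanish.\<close>
      obtain r where r: "r \<in> S" "(t + t') *\<^sub>R r = t *\<^sub>R s + t' *\<^sub>R s'"
      proof (cases "t + t' = 0")
        case True
        then show ?thesis using ps that[of s] by (simp add: add_nonneg_eq_0_iff)
      next
        case False
        then have "0 < t + t'" using ps by simp
        then show ?thesis
          using convexD[OF S(1) ps(3,6), of "t / (t + t')" "t' / (t + t')"] ps(2,5) that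
          by (simp add: scaleR_add_right add_divide_distrib[symmetric])
      qed
      have "q' (x + y) \<le> h (x + y) (t + t', r)" using le r ps by (simp add: I_def)
      also have "\<dots> = q ((x + t *\<^sub>R s) + (y + t' *\<^sub>R s')) - (t + t') * d"
        by (simp only: h_def fst_conv snd_conv r(2)) (simp only: add_ac)
      also have "\<dots> \<le> h x p + h y p'"
        using sublinear_add[OF q, of "x + t *\<^sub>R s" "y + t' *\<^sub>R s'"] by (simp add: h_def ps algebra_simps)
      finally show ?thesis .
    qed
    have "q' (x + y) - q' y \<le> h x p" if "p \<in> I" for p
      using ge[of "q' (x + y) - h x p" y] *[OF that] by (simp add: algebra_simps)
    from ge[OF this] show ?thesis by simp
  qed
  have zero: "q' 0 = 0"
  proof (rule antisym)
    obtain s where "s \<in> S" using S(2) by blast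
    then show "q' 0 \<le> 0" using le[of "(0, s)" 0] sublinear_zero[OF q] by (simp add: h_def I_def)
    show "0 \<le> q' 0" using ge lower[of _ 0] sublinear_zero[OF q] by simp
  qed
  have scale: "q' (t *\<^sub>R x) \<le> t * q' x" if "0 < t" for x t
  proof -
    have "q' (t *\<^sub>R x) / t \<le> h x p" if p: "p \<in> I" for p
    proof -
      obtain a s where ps: "p = (a, s)" "0 \<le> a" "s \<in> S" using p by (auto simp: I_def)
      have "q' (t *\<^sub>R x) \<le> h (t *\<^sub>R x) (t * a, s)" using le ps \<open>0 < t\<close> by (simp add: I_def)
      also have "\<dots> = t * h x p"
        using sublinear_scale[OF q, of t "x + a *\<^sub>R s"] \<open>0 < t\<close> by (simp add: h_def ps algebra_simps)
      finally show ?thesis using \<open>0 < t\<close> by (simp add: divide_simps mult.commute)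
    qed
    from ge[OF this] show ?thesis using \<open>0 < t\<close> by (simp add: divide_simps mult.commute)
  qed
  show ?thesis
  proof
    show "sublinear q'" by (rule sublinearI_pos[OF add zero scale])
    show "q' x \<le> q x" for x
      using S(2) le[of "(0, _)" x] by (auto simp: h_def I_def)
    show "q' (- s) \<le> - d" if "s \<in> S" for s
      using le[of "(1, s)" "- s"] that sublinear_zero[OF q] by (simp add: h_def I_def)
  qed
qed

text \<open>Pushing \<open>q\<close> below itself along the point \<open>a\<close> changes nothing by minimality, and gives
  \<open>q (- a) \<le> - q a\<close>. An odd sublinear functional is linear.\<close>

lemma minimal_sublinear_linear:
  assumes q: "sublinear q" and min: "\<And>q'. sublinear q' \<Longrightarrow> (\<And>x. q' x \<le> q x) \<Longrightarrow> q' = q"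
  shows "linear q"
proof -
  have odd: "q (- a) = - q a" for a
  proof (rule antisym)
    obtain q' where q': "sublinear q'" "\<And>x. q' x \<le> q x" "\<And>s. s \<in> {a} \<Longrightarrow> q' (- s) \<le> - q a"
      using sublinear_push_below[OF q, of "{a}" "q a"] by auto
    with min[OF q'(1,2)] show "q (- a) \<le> - q a" by simp
    show "- q a \<le> q (- a)" using sublinear_minus[OF q, of a] by simp
  qed
  show ?thesis
  proof (rule linearI)
    fix x y
    have "q (x + y) \<ge> q x + q y"
      using sublinear_add[OF q, of "- x" "- y"] odd[of "x + y"] odd[of x] odd[of y] by simp
    with sublinear_add[OF q, of x y] show "q (x + y) = q x + q y" by simp
  next
    fix r :: real and x
    show "q (r *\<^sub>R x) = r *\<^sub>R q x"
      using sublinear_scale[OF q, of r x] sublinear_scale[OF q, of "- r" x] odd[of "r *\<^sub>R x"]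
      by (cases "0 \<le> r") auto
  qed
qed

lemma Inf_chain_sublinear:
  assumes Q: "Q \<noteq> {}" "\<And>q. q \<in> Q \<Longrightarrow> sublinear q" "\<And>q x. q \<in> Q \<Longrightarrow> q x \<le> p x"
    and chain: "\<And>q q'. q \<in> Q \<Longrightarrow> q' \<in> Q \<Longrightarrow> (\<forall>x. q x \<le> q' x) \<or> (\<forall>x. q' x \<le> q x)"
  shows "sublinear (\<lambda>x. INF q\<in>Q. q x)" and "\<And>q x. q \<in> Q \<Longrightarrow> (INF q\<in>Q. q x) \<le> q x"
proof -
  have lower: "- p (- x) \<le> q x" if "q \<in> Q" for q x
    using sublinear_minus[OF Q(2)[OF that], of x] Q(3)[OF that, of "- x"] by linarith
  show le: "(INF q\<in>Q. q x) \<le> q x" if "q \<in> Q" for q x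
    by (rule cINF_lower[OF _ that]) (use lower in \<open>auto intro!: bdd_belowI2\<close>)
  have ge: "c \<le> (INF q\<in>Q. q x)" if "\<And>q. q \<in> Q \<Longrightarrow> c \<le> q x" for c x
    by (rule cINF_greatest[OF Q(1) that])
  show "sublinear (\<lambda>x. INF q\<in>Q. q x)"
  proof (rule sublinearI_pos)
    fix x y
    have *: "(INF q\<in>Q. q (x + y)) \<le> q x + q' y" if "q \<in> Q" "q' \<in> Q" for q q'
      using chain[OF that]
    proof
      assume "\<forall>x. q x \<le> q' x"
      then have "q (x + y) \<le> q x + q' y"
        using sublinear_add[OF Q(2)[OF that(1)], of x y] by (meson add_left_mono order_trans)
      then show ?thesis using le[OF that(1), of "x + y"] by linarith
    next
      assume "\<forall>x. q' x \<le> q x"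
      then have "q' (x + y) \<le> q x + q' y"
        using sublinear_add[OF Q(2)[OF that(2)], of x y] by (meson add_right_mono order_trans)
      then show ?thesis using le[OF that(2), of "x + y"] by linarith
    qed
    have "(INF q\<in>Q. q (x + y)) - (INF q\<in>Q. q y) \<le> q x" if "q \<in> Q" for q
      using ge[of "(INF q\<in>Q. q (x + y)) - q x" y] *[OF that] by (simp add: algebra_simps)
    then have "(INF q\<in>Q. q (x + y)) - (INF q\<in>Q. q y) \<le> (INF q\<in>Q. q x)" by (rule ge)
    then show "(INF q\<in>Q. q (x + y)) \<le> (INF q\<in>Q. q x) + (INF q\<in>Q. q y)" by simp
  next
    show "(INF q\<in>Q. q 0) = 0"
      using Q(1,2) by (simp add: sublinear_zero)
  next
    fix x :: 'a and t :: real assume t: "0 < t"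
    have "(INF q\<in>Q. q (t *\<^sub>R x)) / t \<le> q x" if "q \<in> Q" for q
      using le[OF that, of "t *\<^sub>R x"] sublinear_scale[OF Q(2)[OF that], of t x] t
      by (simp add: divide_simps mult.commute)
    then have "(INF q\<in>Q. q (t *\<^sub>R x)) / t \<le> (INF q\<in>Q. q x)" by (rule ge)
    then show "(INF q\<in>Q. q (t *\<^sub>R x)) \<le> t * (INF q\<in>Q. q x)"
      using t by (simp add: divide_simps mult.commute)
  qed
qed

text \<open>The Hahn-Banach theorem in the form that needs no extension from a subspace: Zorn's lemma,
  applied to the sublinear functionals below \<open>p\<close>, yields a minimal one.\<close>

theorem linear_below_sublinear:
  assumes p: "sublinear p"
  obtains f where "linear f" "\<And>x. f x \<le> p x"
proof -
  define A where "A = {q. sublinear q \<and> (\<forall>x. q x \<le> p x)}"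
  define P where "P q q' \<longleftrightarrow> (\<forall>x. q' x \<le> q x)" for q q' :: "'a \<Rightarrow> real"
  have "\<exists>m\<in>A. \<forall>q\<in>A. P m q \<longrightarrow> q = m"
  proof (rule predicate_Zorn)
    show "partial_order_on A (relation_of P A)"
      by (rule partial_order_on_relation_ofI) (auto simp: P_def intro!: ext intro: order_trans antisym)
  next
    fix Q assume Q: "Q \<in> Chains (relation_of P A)"
    show "\<exists>u\<in>A. \<forall>q\<in>Q. P q u"
    proof (cases "Q = {}")
      case True
      then show ?thesis using p by (auto simp: A_def)
    next
      case False
      have QA: "Q \<subseteq> A" and ch: "\<And>q q'. q \<in> Q \<Longrightarrow> q' \<in> Q \<Longrightarrow> P q q' \<or> P q' q"
        using Q by (auto simp: Chains_def relation_of_def)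
      have s: "\<And>q. q \<in> Q \<Longrightarrow> sublinear q" and le: "\<And>q x. q \<in> Q \<Longrightarrow> q x \<le> p x"
        using QA by (auto simp: A_def)
      have ch': "(\<forall>x. q x \<le> q' x) \<or> (\<forall>x. q' x \<le> q x)" if "q \<in> Q" "q' \<in> Q" for q q'
        using ch[OF that] by (auto simp: P_def)
      have inf: "sublinear (\<lambda>x. INF q\<in>Q. q x)"
        by (rule Inf_chain_sublinear(1)[of Q p]) (fact False s le ch')+
      have Inf_le: "(INF q\<in>Q. q x) \<le> q x" if "q \<in> Q" for q x
        by (rule Inf_chain_sublinear(2)[of Q p]) (fact False s le ch' that)+
      moreover have "(INF q\<in>Q. q x) \<le> p x" for x
        using False Inf_le le by (meson all_not_in_conv order_trans)
      ultimately show ?thesis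
        using inf Inf_le by (intro bexI[of _ "\<lambda>x. INF q\<in>Q. q x"]) (auto simp: A_def P_def)
    qed
  qed
  then obtain m where m: "m \<in> A" "\<And>q. q \<in> A \<Longrightarrow> P m q \<Longrightarrow> q = m" by blast
  have "linear m"
  proof (rule minimal_sublinear_linear)
    show "sublinear m" using m(1) by (simp add: A_def)
    fix q assume q: "sublinear q" "\<And>x. q x \<le> m x"
    have "m x \<le> p x" for x using m(1) by (simp add: A_def)
    then have "q x \<le> p x" for x using q(2) order_trans by blast
    then show "q = m" using q by (intro m(2)) (simp_all add: A_def P_def)
  qed
  with m(1) that show ?thesis by (auto simp: A_def)
qed

text \<open>The norm, pushed below along the translate \<open>S - a\<close> by the distance \<open>d\<close> from \<open>a\<close> to \<open>S\<close>, dominates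
  a linear functional of norm at most 1 that is at least \<open>d\<close> on \<open>S - a\<close>.\<close>

theorem separate_point_closed_convex:
  fixes S :: "'a::real_normed_vector set"
  assumes S: "convex S" "closed S" and a: "a \<notin> S"
  obtains \<phi> :: "'a \<Rightarrow>\<^sub>L real" and d where "0 < d" "\<And>s. s \<in> S \<Longrightarrow> \<phi> a + d \<le> \<phi> s"
proof (cases "S = {}")
  case True
  then show ?thesis using that[of 1] by simp
next
  case False
  define T where "T = (\<lambda>s. s - a) ` S"
  have T: "convex T" "T \<noteq> {}"
    using S(1) False by (auto simp: T_def intro: convex_translation_subtract)
  define d where "d = infdist a S"
  have d: "0 < d" using S(2) a False by (simp add: d_def infdist_pos_not_in_closed)
  have "d \<le> norm t" if "t \<in> T" for t
    using that infdist_le[of _ S a] by (auto simp: T_def d_def dist_norm norm_minus_commute)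
  then obtain q where q: "sublinear q" "\<And>x. q x \<le> norm x" "\<And>t. t \<in> T \<Longrightarrow> q (- t) \<le> - d"
    using sublinear_push_below[OF sublinear_norm T] by metis
  obtain f where f: "linear f" "\<And>x. f x \<le> q x" using linear_below_sublinear[OF q(1)] by blast
  have norm: "\<bar>f x\<bar> \<le> norm x" for x
    using order_trans[OF f(2) q(2), of x] order_trans[OF f(2) q(2), of "- x"] linear_neg[OF f(1), of x]
    by auto
  then have "bounded_linear f"
    using f(1) by (intro bounded_linear_intro[of f 1]) (auto simp: linear_add linear_scale)
  then have app: "blinfun_apply (Blinfun f) = f" by (rule bounded_linear_Blinfun_apply)
  show ?thesis
  proof (rule that[OF d, of "Blinfun f"])
    fix s assume "s \<in> S"
    then have "s - a \<in> T" by (simp add: T_def)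
    then have "f (- (s - a)) \<le> - d" by (rule order_trans[OF f(2) q(3)])
    then show "Blinfun f a + d \<le> Blinfun f s"
      using linear_diff[OF f(1), of a s] by (simp add: app)
  qed
qed

section \<open>Weak compactness in reflexive spaces\<close>

text \<open>Evaluation at all functionals maps a normed space into a power of the reals, which carries the
  product topology as its type-class topology. The weak topology is the initial topology of this map.\<close>

definition dual_coordinates :: "'a::real_normed_vector \<Rightarrow> ('a \<Rightarrow>\<^sub>L real) \<Rightarrow> real" where
  "dual_coordinates x \<phi> = blinfun_apply \<phi> x"

lemma openin_weak_vimage:
  fixes \<phi> :: "'a::real_normed_vector \<Rightarrow>\<^sub>L real"
  assumes "open U"
  shows "openin weak_topology (blinfun_apply \<phi> -` U)"
proof -
  have "blinfun_apply \<phi> -` U \<in> {blinfun_apply \<phi> -` U | (\<phi> :: 'a \<Rightarrow>\<^sub>L real) U. open U}"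
    using assms by blast
  then show ?thesis
    unfolding weak_topology_def by (rule topology_generated_by_Basis)
qed

lemma topspace_weak_topology [simp]: "topspace weak_topology = UNIV"
  using openin_subset[OF openin_weak_vimage[OF open_UNIV]] by (simp add: top.extremum_unique)

lemma openin_weak_dual_coordinates:
  assumes "openin weak_topology U"
  shows "\<exists>V. open V \<and> U = dual_coordinates -` V"
proof -
  have "generate_topology_on {blinfun_apply \<phi> -` U | (\<phi> :: 'a \<Rightarrow>\<^sub>L real) U. open U} U"
    using assms unfolding weak_topology_def by (rule openin_topology_generated_by)
  then show ?thesis
  proof induction
    case Empty
    have "{} = (dual_coordinates :: 'a \<Rightarrow> _) -` {}" by (rule vimage_empty[symmetric])
    with open_empty show ?case by (intro exI conjI)
  next
    case (Int a b)
    from Int.IH obtain V W where V: "open V" "a = dual_coordinates -` V"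
      and W: "open W" "b = dual_coordinates -` W"
      by (elim exE conjE)
    have "a \<inter> b = dual_coordinates -` (V \<inter> W)" by (simp only: V(2) W(2) vimage_Int)
    with open_Int[OF V(1) W(1)] show ?case by (intro exI conjI)
  next
    case (UN \<K>)
    have "\<forall>k\<in>\<K>. \<exists>V. open V \<and> k = dual_coordinates -` V" by (rule ballI) (rule UN.IH)
    from bchoice[OF this] obtain V where V: "\<forall>k\<in>\<K>. open (V k) \<and> k = dual_coordinates -` V k"
      by (elim exE)
    have V_eq: "dual_coordinates -` V k = k" if "k \<in> \<K>" for k
      using bspec[OF V that] by (rule conjunct2[THEN sym])
    have V_open: "open (V k)" if "k \<in> \<K>" for k
      using bspec[OF V that] by (rule conjunct1)
    show ?case
    proof (intro exI conjI)
      show "open (\<Union>k\<in>\<K>. V k)" by (rule open_UN) (simp add: V_open)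
      have "dual_coordinates -` (\<Union>k\<in>\<K>. V k) = (\<Union>k\<in>\<K>. k)"
        unfolding vimage_UN by (rule SUP_cong[OF refl V_eq])
      then show "\<Union>\<K> = dual_coordinates -` (\<Union>k\<in>\<K>. V k)" by simp
    qed
  next
    case (Basis s)
    then obtain \<phi> :: "'a \<Rightarrow>\<^sub>L real" and W where W: "s = blinfun_apply \<phi> -` W" "open W"
      by (elim CollectE exE conjE)
    have "open ((\<lambda>h. h \<phi>) -` W)"
      by (rule open_vimage[OF W(2)]) (rule continuous_on_product_coordinates)
    moreover have "s = dual_coordinates -` ((\<lambda>h. h \<phi>) -` W)"
      by (simp only: W(1) vimage_def mem_Collect_eq dual_coordinates_def)
    ultimately show ?case by (intro exI conjI)
  qed
qed

lemma closedin_weak_imp_closed: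
  assumes "closedin weak_topology S"
  shows "closed S"
proof -
  have "openin weak_topology (- S)" using assms by (simp add: closedin_def Compl_eq_Diff_UNIV)
  then obtain V where V: "open V" "- S = dual_coordinates -` V"
    using openin_weak_dual_coordinates by blast
  have "continuous_on UNIV (dual_coordinates :: 'a \<Rightarrow> _)"
    by (rule continuous_on_coordinatewise_then_product)
      (simp add: dual_coordinates_def linear_continuous_on blinfun.bounded_linear_right)
  from open_vimage[OF V(1) this] have "open (- S)" by (simp only: V(2))
  then show ?thesis by (simp add: closed_def)
qed

text \<open>Mazur's theorem: the functional that separates a point from the set defines a weakly open half
  space around the point that misses the set.\<close>

theorem closedin_weak_convex:
  fixes S :: "'a::real_normed_vector set"
  assumes "convex S" "closed S"
  shows "closedin weak_topology S"
proof -
  have "\<exists>T. openin weak_topology T \<and> a \<in> T \<and> T \<subseteq> - S" if "a \<in> - S" for a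
  proof -
    have "a \<notin> S" using that by simp
    then obtain \<phi> :: "'a \<Rightarrow>\<^sub>L real" and d where d: "0 < d" "\<And>s. s \<in> S \<Longrightarrow> \<phi> a + d \<le> \<phi> s"
      by (rule separate_point_closed_convex[OF assms]) blast
    have "x \<notin> S" if "\<phi> x < \<phi> a + d" for x using d(2)[of x] that by (meson not_less)
    then have "a \<in> blinfun_apply \<phi> -` {..<\<phi> a + d}" "blinfun_apply \<phi> -` {..<\<phi> a + d} \<subseteq> - S"
      using d(1) by auto
    with openin_weak_vimage[OF open_lessThan] show ?thesis by (intro exI conjI)
  qed
  then have "openin weak_topology (- S)" by (subst openin_subopen) blast
  then show ?thesis by (simp add: closedin_def Compl_eq_Diff_UNIV)
qed

lemma abs_functional_le:
  fixes \<phi> :: "'a::real_normed_vector \<Rightarrow>\<^sub>L real"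
  assumes "norm x \<le> R"
  shows "\<bar>\<phi> x\<bar> \<le> norm \<phi> * R"
  using norm_blinfun[of \<phi> x] mult_left_mono[OF assms, of "norm \<phi>"] by simp

text \<open>Additivity, homogeneity and a norm bound are closed conditions on finitely many coordinates, so
  they pass from the image of a bounded set to its closure. Each point of the closure is thus an element
  of the bidual, and reflexivity represents it by a vector.\<close>

lemma closure_dual_coordinates_bounded:
  fixes T :: "'a::real_normed_vector set"
  assumes reflexive: "reflexive_space TYPE('a)" and R: "\<And>x. x \<in> T \<Longrightarrow> norm x \<le> R"
    and h: "h \<in> closure (dual_coordinates ` T)"
  shows "\<exists>x. h = dual_coordinates x"
proof -
  have le: "h \<in> A" if "closed A" "dual_coordinates ` T \<subseteq> A" for A
    using closure_minimal[OF that(2,1)] h by blast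
  have coord: "continuous_on UNIV (\<lambda>h :: ('a \<Rightarrow>\<^sub>L real) \<Rightarrow> real. h \<phi>)" for \<phi>
    by (rule continuous_on_product_coordinates)
  have add: "h (\<phi> + \<psi>) = h \<phi> + h \<psi>" for \<phi> \<psi>
  proof -
    have "h \<in> {h. h (\<phi> + \<psi>) = h \<phi> + h \<psi>}"
    proof (rule le)
      show "closed {h :: ('a \<Rightarrow>\<^sub>L real) \<Rightarrow> real. h (\<phi> + \<psi>) = h \<phi> + h \<psi>}"
        by (intro closed_Collect_eq continuous_on_add coord)
    qed (auto simp: dual_coordinates_def blinfun.add_left)
    then show ?thesis by simp
  qed
  have scale: "h (r *\<^sub>R \<phi>) = r *\<^sub>R h \<phi>" for r \<phi>
  proof -
    have "h \<in> {h. h (r *\<^sub>R \<phi>) = r *\<^sub>R h \<phi>}"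
    proof (rule le)
      show "closed {h :: ('a \<Rightarrow>\<^sub>L real) \<Rightarrow> real. h (r *\<^sub>R \<phi>) = r *\<^sub>R h \<phi>}"
        by (intro closed_Collect_eq continuous_on_scaleR continuous_on_const coord)
    qed (auto simp: dual_coordinates_def blinfun.scaleR_left)
    then show ?thesis by simp
  qed
  have bound: "norm (h \<phi>) \<le> norm \<phi> * R" for \<phi>
  proof -
    have "h \<in> {h. \<bar>h \<phi>\<bar> \<le> norm \<phi> * R}"
    proof (rule le)
      show "closed {h :: ('a \<Rightarrow>\<^sub>L real) \<Rightarrow> real. \<bar>h \<phi>\<bar> \<le> norm \<phi> * R}"
        by (intro closed_Collect_le continuous_on_rabs continuous_on_const coord)
      have "\<bar>\<phi> x\<bar> \<le> norm \<phi> * R" if "x \<in> T" for x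
        using R[OF that] by (rule abs_functional_le)
      then show "dual_coordinates ` T \<subseteq> {h. \<bar>h \<phi>\<bar> \<le> norm \<phi> * R}"
        by (auto simp: dual_coordinates_def)
    qed
    then show ?thesis by simp
  qed
  have "bounded_linear h" by (rule bounded_linear_intro[OF add scale bound])
  then have h': "blinfun_apply (Blinfun h) = h" by (rule bounded_linear_Blinfun_apply)
  obtain x :: 'a where "bidual_embedding x = Blinfun h"
    using reflexive unfolding reflexive_space_def surj_def by metis
  then have "h \<phi> = dual_coordinates x \<phi>" for \<phi>
    by (metis h' bidual_embedding.rep_eq dual_coordinates_def)
  then show ?thesis by blast
qed

text \<open>The coordinates of a bounded set lie in a product of compact intervals, which is compact by
  Tychonoff's theorem, and their image is closed in it: a limit point is the coordinate vector of some
  \<open>x\<close>, and \<open>x\<close> belongs to the weak closure of the set. Compactness is then pulled back.\<close>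

theorem reflexive_compactin_weak:
  fixes T :: "'a::real_normed_vector set"
  assumes reflexive: "reflexive_space TYPE('a)" and T: "closedin weak_topology T" "bounded T"
  shows "compactin weak_topology T"
proof -
  obtain R where R: "\<And>x. x \<in> T \<Longrightarrow> norm x \<le> R" using T(2) by (auto simp: bounded_iff)
  define B :: "(('a \<Rightarrow>\<^sub>L real) \<Rightarrow> real) set" where "B = PiE UNIV (\<lambda>\<phi>. {- (norm \<phi> * R)..norm \<phi> * R})"
  have "compact B"
    unfolding B_def compactin_euclidean_iff[symmetric] euclidean_product_topology[symmetric]
    by (simp add: compactin_PiE)
  moreover have "dual_coordinates ` T \<subseteq> B"
  proof -
    have "\<bar>\<phi> x\<bar> \<le> norm \<phi> * R" if "x \<in> T" for x and \<phi> :: "'a \<Rightarrow>\<^sub>L real"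
      using R[OF that] by (rule abs_functional_le)
    then show ?thesis
      by (intro image_subsetI) (simp add: B_def PiE_iff dual_coordinates_def abs_le_iff minus_le_iff)
  qed
  moreover have "closed (dual_coordinates ` T)"
  proof -
    have "h \<in> dual_coordinates ` T" if h: "h \<in> closure (dual_coordinates ` T)" for h
    proof -
      obtain x where x: "h = dual_coordinates x"
        using closure_dual_coordinates_bounded[OF reflexive R h] by blast
      have "openin weak_topology (- T)" using T(1) by (simp add: closedin_def Compl_eq_Diff_UNIV)
      then obtain V where V: "open V" "- T = dual_coordinates -` V"
        using openin_weak_dual_coordinates by blast
      have "x \<in> T"
      proof (rule ccontr)
        assume "x \<notin> T"
        then have "h \<in> V" using V(2) x by auto
        then have "V \<inter> dual_coordinates ` T \<noteq> {}"
          using open_Int_closure_eq_empty[OF V(1), of "dual_coordinates ` T"] h by blast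
        then obtain y where "y \<in> T" "y \<in> dual_coordinates -` V" by blast
        then show False unfolding V(2)[symmetric] by blast
      qed
      then show ?thesis using x by blast
    qed
    then have "closure (dual_coordinates ` T) \<subseteq> dual_coordinates ` T" by (rule subsetI)
    then show ?thesis by (simp only: closure_subset_eq)
  qed
  ultimately have comp: "compact (dual_coordinates ` T)"
    by (metis compact_Int_closed inf.absorb_iff2)
  show ?thesis
    unfolding compactin_def
  proof (intro conjI allI impI)
    fix \<U> :: "'a set set" assume \<U>: "(\<forall>U\<in>\<U>. openin weak_topology U) \<and> T \<subseteq> \<Union>\<U>"
    then obtain V where V: "\<And>U. U \<in> \<U> \<Longrightarrow> open (V U) \<and> U = dual_coordinates -` V U"
      using openin_weak_dual_coordinates by metis
    have mem: "dual_coordinates x \<in> V U \<longleftrightarrow> x \<in> U" if "U \<in> \<U>" for x U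
    proof -
      have "dual_coordinates -` V U = U" using V[OF that] by (rule conjunct2[THEN sym])
      then show ?thesis using vimage_eq[of x dual_coordinates "V U"] by (simp only:)
    qed
    have "dual_coordinates ` T \<subseteq> \<Union>(V ` \<U>)"
    proof (rule image_subsetI)
      fix x assume "x \<in> T"
      then obtain U where "U \<in> \<U>" "x \<in> U" using \<U> by blast
      then show "dual_coordinates x \<in> \<Union>(V ` \<U>)" using mem by blast
    qed
    moreover have "open (V U)" if "U \<in> \<U>" for U using V[OF that] ..
    ultimately obtain \<F> where \<F>: "\<F> \<subseteq> \<U>" "finite \<F>" "dual_coordinates ` T \<subseteq> \<Union>(V ` \<F>)"
      using compactE_image[OF comp, of \<U> V] by metis
    have "T \<subseteq> \<Union>\<F>"
    proof
      fix x assume "x \<in> T"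
      then obtain U where "U \<in> \<F>" "dual_coordinates x \<in> V U" using \<F>(3) by blast
      then show "x \<in> \<Union>\<F>" using mem \<F>(1) by blast
    qed
    with \<F> show "\<exists>\<F>. finite \<F> \<and> \<F> \<subseteq> \<U> \<and> T \<subseteq> \<Union>\<F>" by blast
  qed simp
qed

section \<open>Fixed points in the cube and the KKM theorem\<close>

text \<open>The unit cube of dimension \<open>n\<close>, with coordinates indexed by numbers and padded with zeros. The
  dimension is a term here because the KKM theorem needs Brouwer's theorem for every number of points,
  whereas a Euclidean type fixes its dimension.\<close>

definition nat_cube :: "nat \<Rightarrow> (nat \<Rightarrow> real) set" where
  "nat_cube n = PiE UNIV (\<lambda>i. if i < n then {0..1} else {0})"

lemma nat_cube_iff: "c \<in> nat_cube n \<longleftrightarrow> (\<forall>i. 0 \<le> c i \<and> c i \<le> 1) \<and> (\<forall>i\<ge>n. c i = 0)"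
proof
  assume "c \<in> nat_cube n"
  then have c: "c i \<in> (if i < n then {0..1} else {0})" for i by (simp add: nat_cube_def PiE_iff)
  have "0 \<le> c i \<and> c i \<le> 1" for i using c[of i] by (cases "i < n") auto
  moreover have "c i = 0" if "i \<ge> n" for i using c[of i] that by simp
  ultimately show "(\<forall>i. 0 \<le> c i \<and> c i \<le> 1) \<and> (\<forall>i\<ge>n. c i = 0)" by blast
qed (auto simp: nat_cube_def PiE_iff)

lemma compact_nat_cube: "compact (nat_cube n)"
  unfolding nat_cube_def compactin_euclidean_iff[symmetric] euclidean_product_topology[symmetric]
  by (simp add: compactin_PiE)

lemma tendsto_coordinatewise_fun:
  fixes f :: "'b \<Rightarrow> 'i \<Rightarrow> 'c::topological_space"
  assumes "\<And>i. ((\<lambda>b. f b i) \<longlongrightarrow> l i) A"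
  shows "(f \<longlongrightarrow> l) A"
  using assms unfolding limitin_canonical_iff[symmetric] euclidean_product_topology[symmetric] limitin_componentwise
  by auto

text \<open>Kuhn's combinatorial lemma on the grid of mesh \<open>1 / Suc k\<close>: a grid point is labelled in
  direction \<open>i\<close> according to whether \<open>g\<close> moves it up or down, and some grid cell carries both labels in
  every direction. The witnesses \<open>a\<close> and \<open>b\<close> are corners of that cell and depend on \<open>i\<close>.\<close>

lemma approximate_fixpoint_nat_cube:
  assumes g: "\<And>c i. c \<in> nat_cube n \<Longrightarrow> i < n \<Longrightarrow> 0 \<le> g c i \<and> g c i \<le> 1"
  shows "\<exists>c\<in>nat_cube n. \<forall>i<n. \<exists>a\<in>nat_cube n. \<exists>b\<in>nat_cube n.
    (\<forall>j. \<bar>a j - c j\<bar> \<le> 1 / Suc k \<and> \<bar>b j - c j\<bar> \<le> 1 / Suc k) \<and> a i \<le> g a i \<and> g b i \<le> (b i :: real)"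
proof -
  define f where "f c i = (if i < n then g c i else 0)" for c i
  have f: "\<forall>c. c \<in> nat_cube n \<longrightarrow> f c \<in> nat_cube n"
    using g by (auto simp: nat_cube_iff f_def)
  have cube: "\<forall>c. c \<in> nat_cube n \<longrightarrow> (\<forall>i. i < n \<longrightarrow> 0 \<le> c i \<and> c i \<le> 1)"
    by (auto simp: nat_cube_iff)
  obtain l :: "(nat \<Rightarrow> real) \<Rightarrow> nat \<Rightarrow> nat" where
    l1: "\<And>c i. l c i \<le> 1"
    and l2: "\<And>c i. c \<in> nat_cube n \<Longrightarrow> i < n \<Longrightarrow> c i = 0 \<Longrightarrow> l c i = 0"
    and l3: "\<And>c i. c \<in> nat_cube n \<Longrightarrow> i < n \<Longrightarrow> c i = 1 \<Longrightarrow> l c i = 1"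
    and l4: "\<And>c i. c \<in> nat_cube n \<Longrightarrow> i < n \<Longrightarrow> l c i = 0 \<Longrightarrow> c i \<le> f c i"
    and l5: "\<And>c i. c \<in> nat_cube n \<Longrightarrow> i < n \<Longrightarrow> l c i = 1 \<Longrightarrow> f c i \<le> c i"
    using kuhn_labelling_lemma'[of "\<lambda>c. c \<in> nat_cube n" f "\<lambda>i. i < n", OF f cube] by (elim exE conjE) (rule that; blast)
  define e where "e q i = (if i < n then real (q i) / real (Suc k) else 0)" for q :: "nat \<Rightarrow> nat" and i
  have e: "e q \<in> nat_cube n" if "\<forall>i<n. q i \<le> Suc k" for q
    using that by (auto simp: nat_cube_iff e_def divide_simps)
  obtain q where q: "\<forall>i<n. q i < Suc k"
    "\<forall>i<n. \<exists>r s. (\<forall>j<n. q j \<le> r j \<and> r j \<le> q j + 1) \<and> (\<forall>j<n. q j \<le> s j \<and> s j \<le> q j + 1) \<and>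
        l (e r) i \<noteq> l (e s) i"
  proof (rule kuhn_lemma[of "Suc k" n "\<lambda>q. l (e q)"])
    show "\<forall>x. (\<forall>i<n. x i \<le> Suc k) \<longrightarrow> (\<forall>i<n. l (e x) i = 0 \<or> l (e x) i = 1)"
      using l1 by (metis One_nat_def le_Suc_eq le_zero_eq)
    show "\<forall>x. (\<forall>i<n. x i \<le> Suc k) \<longrightarrow> (\<forall>i<n. x i = 0 \<longrightarrow> l (e x) i = 0)"
      using l2 e by (simp add: e_def)
    show "\<forall>x. (\<forall>i<n. x i \<le> Suc k) \<longrightarrow> (\<forall>i<n. x i = Suc k \<longrightarrow> l (e x) i = 1)"
      using l3 e by (simp add: e_def del: of_nat_Suc)
  qed (auto intro: that)
  have near: "\<bar>e r j - e q j\<bar> \<le> 1 / Suc k" if "\<forall>j<n. q j \<le> r j \<and> r j \<le> q j + 1" for r j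
  proof (cases "j < n")
    case True
    then have "real (q j) \<le> real (r j)" "real (r j) \<le> real (q j) + 1" using that by (auto simp flip: of_nat_Suc)
    then have "\<bar>real (r j) - real (q j)\<bar> \<le> 1" by simp
    then have "\<bar>real (r j) - real (q j)\<bar> / Suc k \<le> 1 / Suc k" by (rule divide_right_mono) simp
    then show ?thesis using True by (simp add: e_def diff_divide_distrib[symmetric] del: of_nat_Suc)
  qed (simp add: e_def)
  have grid: "e r \<in> nat_cube n" if "\<forall>j<n. q j \<le> r j \<and> r j \<le> q j + 1" for r
    using that q(1) by (intro e) (metis Suc_eq_plus1 Suc_leI order_trans)
  have "\<exists>a\<in>nat_cube n. \<exists>b\<in>nat_cube n.
    (\<forall>j. \<bar>a j - e q j\<bar> \<le> 1 / Suc k \<and> \<bar>b j - e q j\<bar> \<le> 1 / Suc k) \<and> a i \<le> g a i \<and> g b i \<le> b i"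
    if i: "i < n" for i
  proof -
    obtain r s where rs: "\<forall>j<n. q j \<le> r j \<and> r j \<le> q j + 1" "\<forall>j<n. q j \<le> s j \<and> s j \<le> q j + 1"
      "l (e r) i = 0" "l (e s) i = 1"
    proof -
      obtain r s where *: "\<forall>j<n. q j \<le> r j \<and> r j \<le> q j + 1" "\<forall>j<n. q j \<le> s j \<and> s j \<le> q j + 1"
        "l (e r) i \<noteq> l (e s) i"
        using q(2) i by blast
      moreover have "l (e r) i = 0 \<and> l (e s) i = 1 \<or> l (e s) i = 0 \<and> l (e r) i = 1"
        using *(3) l1[of "e r" i] l1[of "e s" i] by linarith
      ultimately show ?thesis using that by blast
    qed
    have "e r i \<le> g (e r) i" "g (e s) i \<le> e s i"
      using l4[OF grid[OF rs(1)] i rs(3)] l5[OF grid[OF rs(2)] i rs(4)] i by (simp_all add: f_def)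
    then show ?thesis
      using near[OF rs(1)] near[OF rs(2)] grid[OF rs(1)] grid[OF rs(2)] by blast
  qed
  moreover have "e q \<in> nat_cube n" using q(1) by (intro e) auto
  ultimately show ?thesis by blast
qed

text \<open>A limit of cells from ever finer grids is a fixed point: in each direction the corners that are
  moved up and those that are moved down both converge to it.\<close>

theorem brouwer_nat_cube:
  fixes g :: "(nat \<Rightarrow> real) \<Rightarrow> nat \<Rightarrow> real"
  assumes g: "\<And>c i. c \<in> nat_cube n \<Longrightarrow> i < n \<Longrightarrow> 0 \<le> g c i \<and> g c i \<le> 1"
    and cont: "\<And>i. i < n \<Longrightarrow> continuous_on (nat_cube n) (\<lambda>c. g c i)"
  obtains c where "c \<in> nat_cube n" "\<And>i. i < n \<Longrightarrow> g c i = c i"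
proof -
  obtain c where c: "\<And>k. c k \<in> nat_cube n" "\<And>k i. i < n \<Longrightarrow> \<exists>a\<in>nat_cube n. \<exists>b\<in>nat_cube n.
    (\<forall>j. \<bar>a j - c k j\<bar> \<le> 1 / Suc k \<and> \<bar>b j - c k j\<bar> \<le> 1 / Suc k) \<and> a i \<le> g a i \<and> g b i \<le> b i"
    using approximate_fixpoint_nat_cube[of n g, OF g] by metis
  obtain r x where r: "strict_mono r" and x: "x \<in> nat_cube n" and lim: "(c \<circ> r) \<longlonglongrightarrow> x"
    using compact_nat_cube[of n] c(1) unfolding compact_eq_seq_compact_metric seq_compact_def by metis
  have limj: "(\<lambda>k. c (r k) j) \<longlonglongrightarrow> x j" for j
  proof -
    have "limitin (product_topology (\<lambda>i. euclidean) UNIV) (c \<circ> r) x sequentially"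
      using lim by (simp add: euclidean_product_topology)
    then show ?thesis by (simp add: limitin_componentwise o_def)
  qed
  have small: "(\<lambda>k. 1 / real (Suc (r k))) \<longlonglongrightarrow> 0"
    using LIMSEQ_subseq_LIMSEQ[OF LIMSEQ_inverse_real_of_nat r] by (simp add: o_def inverse_eq_divide)
  have near: "(\<lambda>k. a (r k)) \<longlonglongrightarrow> x" if "\<And>k j. \<bar>a k j - c k j\<bar> \<le> 1 / Suc k" for a
  proof (rule tendsto_coordinatewise_fun)
    fix j
    have "(\<lambda>k. a (r k) j - c (r k) j) \<longlonglongrightarrow> 0"
      by (rule tendsto_0_le[OF small, of _ 1]) (use that in auto)
    from tendsto_add[OF this limj[of j]] show "(\<lambda>k. a (r k) j) \<longlonglongrightarrow> x j" by simp
  qed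
  have "g x i = x i" if i: "i < n" for i
  proof -
    obtain a b where a: "\<And>k. a k \<in> nat_cube n" "\<And>k j. \<bar>a k j - c k j\<bar> \<le> 1 / Suc k" "\<And>k. a k i \<le> g (a k) i"
      and b: "\<And>k. b k \<in> nat_cube n" "\<And>k j. \<bar>b k j - c k j\<bar> \<le> 1 / Suc k" "\<And>k. g (b k) i \<le> b k i"
      using c(2)[OF i] by metis
    have coord: "(\<lambda>k. u (r k) i) \<longlonglongrightarrow> x i" and image: "(\<lambda>k. g (u (r k)) i) \<longlonglongrightarrow> g x i"
      if u: "\<And>k. u k \<in> nat_cube n" "\<And>k j. \<bar>u k j - c k j\<bar> \<le> 1 / Suc k" for u
    proof -
      have ulim: "(\<lambda>k. u (r k)) \<longlonglongrightarrow> x" by (rule near[OF u(2)])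
      show "(\<lambda>k. g (u (r k)) i) \<longlonglongrightarrow> g x i"
        using continuous_on_tendsto_compose[OF cont[OF i] ulim x] u(1) by simp
      show "(\<lambda>k. u (r k) i) \<longlonglongrightarrow> x i"
        using continuous_on_tendsto_compose[OF continuous_on_product_coordinates[of i] ulim] by simp
    qed
    have "x i \<le> g x i"
      by (rule LIMSEQ_le[OF coord[OF a(1,2)] image[OF a(1,2)]]) (use a(3) in auto)
    moreover have "g x i \<le> x i"
      by (rule LIMSEQ_le[OF image[OF b(1,2)] coord[OF b(1,2)]]) (use b(3) in auto)
    ultimately show ?thesis by simp
  qed
  with x that show ?thesis by blast
qed

text \<open>The Knaster-Kuratowski-Mazurkiewicz theorem for finitely many points. If no point of the hull lay
  in all the sets, the distances to the sets, normalised to sum 1, would be continuous barycentric weights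
  on the hull. Brouwer's theorem gives a point \<open>x\<close> that is the combination of the \<open>y i\<close> with its own
  weights. By the covering hypothesis \<open>x\<close> belongs to the set of some \<open>y i\<close> of nonzero weight, which
  contradicts that this weight is proportional to the distance from \<open>x\<close> to that set.\<close>

theorem KKM_finite:
  fixes G :: "'a::real_normed_vector \<Rightarrow> 'a set"
  assumes Y: "finite Y" "Y \<noteq> {}"
    and closed: "\<And>y. y \<in> Y \<Longrightarrow> closed (G y)"
    and cover: "\<And>Z. Z \<subseteq> Y \<Longrightarrow> convex hull Z \<subseteq> (\<Union>y\<in>Z. G y)"
  shows "convex hull Y \<inter> (\<Inter>y\<in>Y. G y) \<noteq> {}"
proof
  assume empty: "convex hull Y \<inter> (\<Inter>y\<in>Y. G y) = {}"
  obtain y where y: "bij_betw y {0..<card Y} Y" using ex_bij_betw_nat_finite[OF Y(1)] by blast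
  define n where "n = card Y"
  have n: "0 < n" using Y by (simp add: n_def card_gt_0_iff)
  have yY: "y i \<in> Y" if "i < n" for i
    using y that by (auto simp: n_def bij_betw_def)
  have yimage: "Y = y ` {..<n}"
    using y by (auto simp: n_def bij_betw_def atLeast0LessThan)
  define H where "H i = G (y i) \<inter> convex hull Y" for i
  have "compact (convex hull Y)" using Y(1) by (rule finite_imp_compact_convex_hull)
  have H_closed: "closed (H i)" if "i < n" for i
    unfolding H_def
    by (rule closed_Int[OF closed[OF yY[OF that]] compact_imp_closed[OF \<open>compact (convex hull Y)\<close>]])
  have H_ne: "H i \<noteq> {}" if "i < n" for i
  proof -
    have "y i \<in> G (y i)" using cover[of "{y i}"] yY[OF that] by simp
    moreover have "y i \<in> convex hull Y" using yY[OF that] by (rule hull_inc)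
    ultimately show ?thesis unfolding H_def by blast
  qed
  define d where "d i x = infdist x (H i)" for i x
  define D where "D x = (\<Sum>i<n. d i x)" for x
  have d_nonneg: "0 \<le> d i x" for i x by (simp add: d_def infdist_nonneg)
  have D_pos: "0 < D x" if x: "x \<in> convex hull Y" for x
  proof (rule ccontr)
    assume "\<not> 0 < D x"
    then have "D x = 0" using sum_nonneg[of "{..<n}" "\<lambda>i. d i x"] d_nonneg by (force simp: D_def)
    then have "d i x = 0" if "i < n" for i
      using that d_nonneg by (auto simp: D_def sum_nonneg_eq_0_iff)
    then have "x \<in> H i" if "i < n" for i
      using in_closed_iff_infdist_zero[OF H_closed[OF that] H_ne[OF that]] that by (simp add: d_def)
    then have "x \<in> convex hull Y \<inter> (\<Inter>y\<in>Y. G y)" using x by (auto simp: H_def yimage)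
    with empty show False by blast
  qed
  \<comment> \<open>A parametrisation \<open>p\<close> of the hull by the whole cube: coordinates with sum above 1 are rescaled,\<close>
  \<comment> \<open>and weight missing from 1 goes to \<open>y 0\<close>. Coordinates with sum 1 are left unchanged.\<close>
  define t where "t c i = c i / max 1 (\<Sum>j<n. c j)" for c :: "nat \<Rightarrow> real" and i
  define u where "u c i = t c i + (if i = 0 then 1 - (\<Sum>j<n. t c j) else 0)" for c i
  define p where "p c = (\<Sum>i<n. u c i *\<^sub>R y i)" for c
  have u_sum: "(\<Sum>i<n. u c i) = 1" for c
    using n by (simp add: u_def sum.distrib sum.delta)
  have u_nonneg: "0 \<le> u c i" if "c \<in> nat_cube n" for c i
  proof -
    have c: "0 \<le> c j" for j using that by (auto simp: nat_cube_iff)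
    have "(\<Sum>j<n. t c j) = (\<Sum>j<n. c j) / max 1 (\<Sum>j<n. c j)"
      by (simp add: t_def sum_divide_distrib)
    also have "\<dots> \<le> 1" by (simp add: divide_simps)
    finally show ?thesis using c[of i] by (auto simp: u_def t_def)
  qed
  have p_hull: "p c \<in> convex hull Y" if "c \<in> nat_cube n" for c
    unfolding p_def using u_sum u_nonneg[OF that] yY
    by (intro convex_sum convex_convex_hull) (auto intro: hull_inc)
  have p_cont: "continuous_on (nat_cube n) p"
  proof -
    have coord: "continuous_on (nat_cube n) (\<lambda>c. c i)" for i
      by (rule continuous_on_subset[OF continuous_on_product_coordinates]) simp
    have t_cont: "continuous_on (nat_cube n) (\<lambda>c. t c i)" for i
      unfolding t_def by (intro continuous_intros coord) (simp add: max_def)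
    have "continuous_on (nat_cube n) (\<lambda>c. u c i)" for i
      unfolding u_def by (cases "i = 0") (auto intro!: continuous_intros t_cont)
    then show ?thesis unfolding p_def by (intro continuous_intros)
  qed
  have d_cont: "continuous_on (nat_cube n) (\<lambda>c. d i (p c))" for i
    unfolding d_def by (intro continuous_on_infdist p_cont)
  have weight: "0 \<le> d i (p c) / D (p c) \<and> d i (p c) / D (p c) \<le> 1"
    if c: "c \<in> nat_cube n" and i: "i < n" for c i
  proof -
    have "d i (p c) \<le> D (p c)"
      unfolding D_def using i d_nonneg by (intro member_le_sum) auto
    then show ?thesis
      using D_pos[OF p_hull[OF c]] d_nonneg by (simp add: divide_simps)
  qed
  have weight_cont: "continuous_on (nat_cube n) (\<lambda>c. d i (p c) / D (p c))" for i
  proof -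
    have "D (p c) \<noteq> 0" if "c \<in> nat_cube n" for c using D_pos[OF p_hull[OF that]] by simp
    then show ?thesis
      using d_cont unfolding D_def by (intro continuous_intros) auto
  qed
  obtain c where c: "c \<in> nat_cube n" and fixed: "\<And>i. i < n \<Longrightarrow> d i (p c) / D (p c) = c i"
    using brouwer_nat_cube[of n "\<lambda>c i. d i (p c) / D (p c)", OF weight weight_cont] by blast
  have Dp: "D (p c) > 0" using D_pos[OF p_hull[OF c]] .
  have "(\<Sum>i<n. c i) = (\<Sum>i<n. d i (p c) / D (p c))" using fixed by (intro sum.cong) auto
  also have "\<dots> = 1" using Dp by (simp add: sum_divide_distrib[symmetric] D_def)
  finally have c_sum: "(\<Sum>i<n. c i) = 1" .
  have t_c: "t c i = c i" for i by (simp add: t_def c_sum)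
  then have "u c i = c i" for i by (simp add: u_def c_sum)
  then have p_c: "p c = (\<Sum>i<n. c i *\<^sub>R y i)" by (simp add: p_def)
  define J where "J = {i. i < n \<and> c i \<noteq> 0}"
  have J: "J \<subseteq> {..<n}" "finite J" by (auto simp: J_def)
  have "p c = (\<Sum>i\<in>J. c i *\<^sub>R y i)"
    unfolding p_c by (rule sum.mono_neutral_right) (auto simp: J_def)
  moreover have "(\<Sum>i\<in>J. c i) = 1"
    unfolding c_sum[symmetric] by (rule sum.mono_neutral_left) (auto simp: J_def)
  moreover have "0 \<le> c i" for i using c by (simp add: nat_cube_iff)
  ultimately have "p c \<in> convex hull (y ` J)"
    using convex_sum[OF J(2) convex_convex_hull, of c y "y ` J"] by (simp add: hull_inc)
  moreover have "y ` J \<subseteq> Y" using J yY by auto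
  ultimately obtain i where i: "i \<in> J" "p c \<in> G (y i)" using cover[of "y ` J"] by auto
  then have "p c \<in> H i" using p_hull[OF c] by (simp add: H_def)
  then have "d i (p c) = 0" by (simp add: d_def)
  then show False using fixed[of i] i(1) by (simp add: J_def)
qed

section \<open>Convex cones and strictly negative values\<close>

lemma mem_uminus_image_iff: "x \<in> uminus ` A \<longleftrightarrow> - x \<in> A" for x :: "'z::group_add"
  by (metis image_iff minus_minus)

lemma open_uminus_image:
  fixes A :: "'z::topological_ab_group_add set"
  assumes "open A"
  shows "open (uminus ` A)"
proof -
  have "uminus ` A = uminus -` A" by (auto simp: mem_uminus_image_iff)
  then show ?thesis using assms by (simp add: open_vimage continuous_intros)
qed

text \<open>The translate of the interior by an element of the cone is open and stays inside the cone.\<close>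

lemma interior_cone_add:
  fixes C :: "'z::topological_ab_group_add set"
  assumes C: "C + C = C" and x: "x \<in> interior C" and c: "c \<in> C"
  shows "x + c \<in> interior C"
proof (rule interiorI)
  show "open ((\<lambda>z. z - c) -` interior C)" by (intro open_vimage continuous_intros) simp
  show "x + c \<in> (\<lambda>z. z - c) -` interior C" using x by simp
  show "(\<lambda>z. z - c) -` interior C \<subseteq> C"
  proof
    fix z assume "z \<in> (\<lambda>z. z - c) -` interior C"
    then have "z - c \<in> C" using interior_subset by auto
    from set_plus_intro[OF this c] show "z \<in> C" using C by simp
  qed
qed

lemma continuous_on_scaleR_topological:
  "continuous_on A (\<lambda>z::'z::topological_real_vector. t *\<^sub>R z)"
  unfolding continuous_on_def
proof
  fix a
  have "((\<lambda>z. (t, z)) \<longlongrightarrow> (t, a)) (at a within A)" by (intro tendsto_intros)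
  then have "filterlim (\<lambda>z. (t, z)) (nhds t \<times>\<^sub>F nhds a) (at a within A)" by (simp add: nhds_prod)
  from filterlim_compose[OF tendsto_scaleR_Pair_nhds this]
  show "((\<lambda>z. t *\<^sub>R z) \<longlongrightarrow> t *\<^sub>R a) (at a within A)" by simp
qed

lemma interior_cone_scale:
  fixes C :: "'z::topological_real_vector set"
  assumes C: "cone C" and t: "0 < t" and x: "x \<in> interior C"
  shows "t *\<^sub>R x \<in> interior C"
proof (rule interiorI)
  show "open ((\<lambda>z. inverse t *\<^sub>R z) -` interior C)"
    by (intro open_vimage continuous_on_scaleR_topological) simp
  show "t *\<^sub>R x \<in> (\<lambda>z. inverse t *\<^sub>R z) -` interior C" using x t by simp
  show "(\<lambda>z. inverse t *\<^sub>R z) -` interior C \<subseteq> C"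
  proof
    fix z assume "z \<in> (\<lambda>z. inverse t *\<^sub>R z) -` interior C"
    then have "inverse t *\<^sub>R z \<in> C" using interior_subset by auto
    with C t have "t *\<^sub>R inverse t *\<^sub>R z \<in> C" unfolding cone_def by (meson less_imp_le)
    then show "z \<in> C" using t by simp
  qed
qed

text \<open>A positive share of a strictly negative value makes the combination strictly negative, since
  adding elements of the cone, including the convexity defect of \<open>f\<close>, does not leave the interior.\<close>

lemma cone_convex_on_negative_combination:
  fixes f :: "'a::real_vector \<Rightarrow> 'z::topological_real_vector"
  assumes C: "cone C" "C + C = C" and f: "cone_convex_on C K f"
    and xy: "x \<in> K" "y \<in> K" and t: "0 < t" "t \<le> 1"
    and fx: "f x \<in> uminus ` interior C" and fy: "f y \<in> uminus ` C"
  shows "f (t *\<^sub>R x + (1 - t) *\<^sub>R y) \<in> uminus ` interior C"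
proof -
  let ?z = "t *\<^sub>R x + (1 - t) *\<^sub>R y"
  have "t *\<^sub>R (- f x) \<in> interior C"
    using fx by (intro interior_cone_scale[OF C(1) t(1)]) (simp add: mem_uminus_image_iff)
  moreover have "(1 - t) *\<^sub>R (- f y) \<in> C"
    using fy C(1) t(2) unfolding mem_uminus_image_iff by (intro mem_cone) simp_all
  moreover have "t *\<^sub>R f x + (1 - t) *\<^sub>R f y - f ?z \<in> C"
    using f xy t by (auto simp: cone_convex_on_def)
  ultimately have "t *\<^sub>R (- f x) + (1 - t) *\<^sub>R (- f y) + (t *\<^sub>R f x + (1 - t) *\<^sub>R f y - f ?z) \<in> interior C"
    by (intro interior_cone_add[OF C(2)])
  then show ?thesis by (simp add: mem_uminus_image_iff)
qed

lemma convex_strictly_negative_set: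
  fixes f :: "'a::real_vector \<Rightarrow> 'z::topological_real_vector"
  assumes C: "cone C" "C + C = C" and K: "convex K" and f: "cone_convex_on C K f"
  shows "convex {y \<in> K. f y \<in> uminus ` interior C}"
proof (rule convexI)
  fix x y :: 'a and u v :: real
  assume x: "x \<in> {y \<in> K. f y \<in> uminus ` interior C}" and y: "y \<in> {y \<in> K. f y \<in> uminus ` interior C}"
    and uv: "0 \<le> u" "0 \<le> v" "u + v = 1"
  have "f (u *\<^sub>R x + v *\<^sub>R y) \<in> uminus ` interior C"
  proof (cases "u = 0")
    case True
    then show ?thesis using y uv by simp
  next
    case False
    have v: "v = 1 - u" and u: "0 < u" "u \<le> 1" using uv False by auto
    have "f y \<in> uminus ` C" using y interior_subset[of C] by blast
    then show ?thesis
      unfolding v using cone_convex_on_negative_combination[OF C f _ _ u, of x y] x y by simp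
  qed
  with x y uv K show "u *\<^sub>R x + v *\<^sub>R y \<in> {y \<in> K. f y \<in> uminus ` interior C}"
    by (simp add: convexD)
qed

text \<open>The canonical net: pairs of an open neighbourhood of \<open>x\<close> and a point of \<open>G\<close> in it, ordered by
  reverse inclusion of the neighbourhoods.\<close>

lemma net_to_closure_point:
  assumes x: "x \<in> T closure_of G"
  obtains D :: "'a net_index set" and le where
    "directed_set D le" "\<And>\<alpha>. \<alpha> \<in> D \<Longrightarrow> fst \<alpha> \<in> G" "limitin T fst x (net_filter D le)"
proof -
  have xT: "x \<in> topspace T" and meets: "\<And>U. openin T U \<Longrightarrow> x \<in> U \<Longrightarrow> U \<inter> G \<noteq> {}"
    using x by (auto simp: in_closure_of)
  define D where "D = {(u, U). openin T U \<and> x \<in> U \<and> u \<in> U \<inter> G}"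
  define le :: "'a net_index \<Rightarrow> 'a net_index \<Rightarrow> bool" where "le a b \<longleftrightarrow> snd b \<subseteq> snd a" for a b
  have ex: "\<exists>u. (u, U) \<in> D" if "openin T U" "x \<in> U" for U
  proof -
    from meets[OF that] obtain u where "u \<in> U \<inter> G" by blast
    then have "(u, U) \<in> D" using that by (simp add: D_def)
    then show ?thesis ..
  qed
  have dir: "directed_set D le"
    unfolding directed_set_def
  proof (intro conjI ballI impI)
    show "D \<noteq> {}" using ex[OF openin_topspace xT] by blast
  next
    fix a b assume "a \<in> D" "b \<in> D"
    then have "openin T (snd a \<inter> snd b)" "x \<in> snd a \<inter> snd b" by (auto simp: D_def)
    then obtain u where "(u, snd a \<inter> snd b) \<in> D" using ex by blast
    then show "\<exists>c\<in>D. le a c \<and> le b c" by (intro bexI[of _ "(u, snd a \<inter> snd b)"]) (simp_all add: le_def)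
  qed (auto simp: le_def)
  have "limitin T fst x (net_filter D le)"
    unfolding limitin_def eventually_net_filter[OF dir]
  proof (intro conjI allI impI xT)
    fix U assume "openin T U \<and> x \<in> U"
    then obtain u where "(u, U) \<in> D" using ex by blast
    then show "\<exists>d\<in>D. \<forall>e\<in>D. le d e \<longrightarrow> fst e \<in> U"
      by (intro bexI[of _ "(u, U)"]) (auto simp: le_def D_def)
  qed
  with dir show ?thesis by (intro that[of D le]) (auto simp: D_def)
qed

text \<open>A point of the closure of this set is the limit of a net in it. The first alternative applies to that net as it stands. Under either of the
  others, a value \<open>f x\<close> in the open set \<open>- interior C\<close> would force the value at some point of the set into
  \<open>- interior C - C\<close>, which is contained in \<open>- interior C\<close>.\<close>

lemma closedin_not_strictly_negative:
  fixes f :: "'a \<Rightarrow> 'z::topological_real_vector"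
  assumes C: "C + C = C" and K: "closedin T K"
    and f: "(\<forall>(D :: 'a net_index set) le xn x.
         directed_set D le \<longrightarrow> (\<forall>\<alpha>\<in>D. xn \<alpha> \<in> K) \<longrightarrow> x \<in> K \<longrightarrow>
         limitin T xn x (net_filter D le) \<longrightarrow>
         (\<forall>\<alpha>\<in>D. f (xn \<alpha>) \<notin> uminus ` interior C) \<longrightarrow> f x \<notin> uminus ` interior C)
      \<or> cone_usc_on T C K f
      \<or> (\<forall>x\<in>K. \<forall>(D :: 'a net_index set) le xn.
           directed_set D le \<longrightarrow> (\<forall>\<alpha>\<in>D. xn \<alpha> \<in> K) \<longrightarrow>
           limitin T xn x (net_filter D le) \<longrightarrow>
           (\<exists>zn z. (zn \<longlongrightarrow> z) (net_filter D le) \<and>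
              (\<forall>\<alpha>\<in>D. f (xn \<alpha>) - zn \<alpha> \<in> uminus ` C) \<and> f x - z \<in> C))"
  shows "closedin T {x \<in> K. f x \<notin> uminus ` interior C}" (is "closedin T ?G")
proof -
  have GK: "?G \<subseteq> K" by blast
  have KT: "K \<subseteq> topspace T" using K by (rule closedin_subset)
  have open_neg: "open (uminus ` interior C)" by (intro open_uminus_image open_interior)
  have "x \<in> ?G" if x: "x \<in> T closure_of ?G" for x
  proof -
    have "x \<in> K" using closure_of_minimal[OF GK K] x by blast
    have meets: "U \<inter> ?G \<noteq> {}" if "openin T U" "x \<in> U" for U
      using x that by (auto simp: in_closure_of)
    obtain D :: "'a net_index set" and le where
      net: "directed_set D le" "\<And>\<alpha>. \<alpha> \<in> D \<Longrightarrow> fst \<alpha> \<in> ?G" "limitin T fst x (net_filter D le)"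
      by (rule net_to_closure_point[OF x]) (rule that; blast)
    have net_K: "fst \<alpha> \<in> K" if "\<alpha> \<in> D" for \<alpha> using net(2)[OF that] by simp
    from f have "f x \<notin> uminus ` interior C"
    proof (elim disjE)
      assume "\<forall>(D :: 'a net_index set) le xn x.
         directed_set D le \<longrightarrow> (\<forall>\<alpha>\<in>D. xn \<alpha> \<in> K) \<longrightarrow> x \<in> K \<longrightarrow>
         limitin T xn x (net_filter D le) \<longrightarrow>
         (\<forall>\<alpha>\<in>D. f (xn \<alpha>) \<notin> uminus ` interior C) \<longrightarrow> f x \<notin> uminus ` interior C"
      from this[rule_format, OF net(1) net_K \<open>x \<in> K\<close> net(3)] net(2) show ?thesis by simp
    next
      assume usc: "cone_usc_on T C K f"
      show ?thesis
      proof
        assume "f x \<in> uminus ` interior C"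
        then have "f x \<in> interior (uminus ` interior C)" using interior_open[OF open_neg] by simp
        with usc \<open>x \<in> K\<close> obtain U where
          U: "x \<in> T interior_of U" "\<forall>u\<in>U \<inter> K. f u \<in> uminus ` interior C + uminus ` C"
          unfolding cone_usc_on_def by metis
        then obtain u where u: "u \<in> U" "u \<in> ?G"
          using meets[OF openin_interior_of U(1)] interior_of_subset[of T U] by blast
        from u have "f u \<in> uminus ` interior C + uminus ` C" using U(2) by simp
        then obtain a b where "a \<in> interior C" "b \<in> C" "f u = - a + - b"
          by (elim set_plus_elim imageE) simp
        then have "- f u \<in> interior C" using interior_cone_add[OF C, of a b] by (simp add: add.commute)
        with u(2) show False by (simp add: mem_uminus_image_iff)
      qed
    next
      assume "\<forall>x\<in>K. \<forall>(D :: 'a net_index set) le xn.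
           directed_set D le \<longrightarrow> (\<forall>\<alpha>\<in>D. xn \<alpha> \<in> K) \<longrightarrow>
           limitin T xn x (net_filter D le) \<longrightarrow>
           (\<exists>zn z. (zn \<longlongrightarrow> z) (net_filter D le) \<and>
              (\<forall>\<alpha>\<in>D. f (xn \<alpha>) - zn \<alpha> \<in> uminus ` C) \<and> f x - z \<in> C)"
      from this[rule_format, OF \<open>x \<in> K\<close> net(1) _ net(3)] net_K
      have "\<exists>zn z. (zn \<longlongrightarrow> z) (net_filter D le) \<and>
          (\<forall>\<alpha>\<in>D. f (fst \<alpha>) - zn \<alpha> \<in> uminus ` C) \<and> f x - z \<in> C"
        by blast
      then obtain zn z where
        z: "(zn \<longlongrightarrow> z) (net_filter D le)" "\<forall>\<alpha>\<in>D. f (fst \<alpha>) - zn \<alpha> \<in> uminus ` C" "f x - z \<in> C"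
        by (elim exE conjE)
      show ?thesis
      proof
        assume "f x \<in> uminus ` interior C"
        then have "- f x + (f x - z) \<in> interior C"
          using z(3) by (intro interior_cone_add[OF C]) (simp_all add: mem_uminus_image_iff)
        then have "z \<in> uminus ` interior C" by (simp add: mem_uminus_image_iff)
        then have "eventually (\<lambda>\<alpha>. zn \<alpha> \<in> uminus ` interior C) (net_filter D le)"
          by (rule topological_tendstoD[OF z(1) open_neg])
        then obtain d where d: "d \<in> D" and tail: "\<forall>e\<in>D. le d e \<longrightarrow> zn e \<in> uminus ` interior C"
          unfolding eventually_net_filter[OF net(1)] by (elim bexE)
        have "le d d" using net(1) d unfolding directed_set_def by (elim conjE) (rule bspec)
        with tail d have "- zn d \<in> interior C" by (simp add: mem_uminus_image_iff)
        then have "- zn d + (zn d - f (fst d)) \<in> interior C"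
          using z(2) d by (intro interior_cone_add[OF C]) (auto simp: mem_uminus_image_iff)
        with net(2)[OF d] show False by (simp add: mem_uminus_image_iff)
      qed
    qed
    with \<open>x \<in> K\<close> show ?thesis by blast
  qed
  then show ?thesis
    using GK KT closure_of_subset_eq[of ?G T] by blast
qed

section \<open>Existence of an equilibrium point\<close>

theorem theorem4p4:
  fixes K :: "'x::banach set"
    and C :: "'z::{topological_real_vector, t2_space} set"
    and F :: "'x \<Rightarrow> 'x \<Rightarrow> 'x \<Rightarrow> 'z"
  assumes reflexive: "reflexive_space TYPE('x)"
    and cone: "cone C"
    and convex_cone: "C + C = C"
    and pointed: "C \<inter> uminus ` C = {0}"
    and int_nonempty: "interior C \<noteq> {}"
    and K: "K \<noteq> {}" "convex K" "closed K"
    and i: "\<And>y. y \<in> K \<Longrightarrow>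
      (\<forall>(D :: 'x net_index set) le xn x.
         directed_set D le \<longrightarrow> (\<forall>\<alpha>\<in>D. xn \<alpha> \<in> K) \<longrightarrow> x \<in> K \<longrightarrow>
         limitin weak_topology xn x (net_filter D le) \<longrightarrow>
         (\<forall>\<alpha>\<in>D. F (xn \<alpha>) y (xn \<alpha>) \<notin> uminus ` interior C) \<longrightarrow>
         F x y x \<notin> uminus ` interior C)
      \<or> cone_usc_on weak_topology C K (\<lambda>x. F x y x)
      \<or> (\<forall>x\<in>K. \<forall>(D :: 'x net_index set) le xn.
           directed_set D le \<longrightarrow> (\<forall>\<alpha>\<in>D. xn \<alpha> \<in> K) \<longrightarrow>
           limitin weak_topology xn x (net_filter D le) \<longrightarrow>
           (\<exists>zn z. (zn \<longlongrightarrow> z) (net_filter D le) \<and>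
              (\<forall>\<alpha>\<in>D. F (xn \<alpha>) y (xn \<alpha>) - zn \<alpha> \<in> uminus ` C) \<and>
              F x y x - z \<in> C))"
    and ii: "\<And>x. x \<in> K \<Longrightarrow> cone_convex_on C K (\<lambda>y. F x y x)"
    and iii: "\<And>x. x \<in> K \<Longrightarrow> F x x x \<in> uminus ` C - uminus ` interior C"
    and iv: "\<exists>r>0. K \<inter> cball 0 r \<noteq> {} \<and>
      (\<forall>x\<in>K. norm x = r \<longrightarrow> (\<exists>y0\<in>K. norm y0 < r \<and> F x y0 x \<in> uminus ` C))"
  shows "\<exists>x0\<in>K. \<forall>y\<in>K. F x0 y x0 \<notin> uminus ` interior C"
proof -
  obtain r where r: "0 < r" "K \<inter> cball 0 r \<noteq> {}"
    and coercive: "\<And>x. x \<in> K \<Longrightarrow> norm x = r \<Longrightarrow> \<exists>y0\<in>K. norm y0 < r \<and> F x y0 x \<in> uminus ` C"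
    using iv by blast
  define Kr where "Kr = K \<inter> cball 0 r"
  define G where "G y = {x \<in> K. F x y x \<notin> uminus ` interior C}" for y
  have G_closed: "closedin weak_topology (G y)" if "y \<in> K" for y
    unfolding G_def
    by (rule closedin_not_strictly_negative[OF convex_cone closedin_weak_convex[OF K(2,3)] i[OF that]])
  have Kr: "convex Kr" "closed Kr" "bounded Kr"
    using K by (auto simp: Kr_def intro: convex_Int closed_Int bounded_Int)
  have compact: "compactin weak_topology Kr"
    using reflexive_compactin_weak[OF reflexive closedin_weak_convex[OF Kr(1,2)] Kr(3)] .
  have cover: "convex hull Z \<subseteq> (\<Union>y\<in>Z. G y)" if Z: "Z \<subseteq> Kr" for Z
  proof (rule ccontr)
    assume "\<not> ?thesis"
    then obtain x where x: "x \<in> convex hull Z" "\<And>y. y \<in> Z \<Longrightarrow> x \<notin> G y" by blast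
    have "x \<in> K" using x(1) hull_minimal[of Z K convex] Z K(2) by (auto simp: Kr_def)
    let ?N = "{y \<in> K. F x y x \<in> uminus ` interior C}"
    have "Z \<subseteq> ?N" using x(2) \<open>x \<in> K\<close> Z by (auto simp: G_def Kr_def)
    moreover have "convex ?N"
      by (rule convex_strictly_negative_set[OF cone convex_cone K(2) ii[OF \<open>x \<in> K\<close>]])
    ultimately have "x \<in> ?N" using x(1) hull_minimal by blast
    with iii[OF \<open>x \<in> K\<close>] show False by blast
  qed
  have "Kr \<inter> \<Inter>(G ` Kr) \<noteq> {}"
  proof -
    have "Kr \<inter> \<Inter>\<F> \<noteq> {}" if "finite \<F>" "\<F> \<subseteq> G ` Kr" for \<F>
    proof -
      from finite_subset_image[OF that] obtain Y where Y: "Y \<subseteq> Kr" "finite Y" "\<F> = G ` Y"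
        by blast
      show ?thesis
      proof (cases "Y = {}")
        case True
        then show ?thesis using Y(3) r(2) by (simp add: Kr_def)
      next
        case False
        have "convex hull Y \<inter> (\<Inter>y\<in>Y. G y) \<noteq> {}"
        proof (rule KKM_finite[OF Y(2) False])
          show "closed (G y)" if "y \<in> Y" for y
            using Y(1) that by (intro closedin_weak_imp_closed G_closed) (auto simp: Kr_def)
          show "convex hull Z \<subseteq> (\<Union>y\<in>Z. G y)" if "Z \<subseteq> Y" for Z
            using Y(1) that by (intro cover) blast
        qed
        moreover have "convex hull Y \<subseteq> Kr" using Y(1) Kr(1) by (rule hull_minimal)
        ultimately show ?thesis using Y(3) by blast
      qed
    qed
    moreover have "closedin weak_topology A" if "A \<in> G ` Kr" for A
      using that G_closed by (auto simp: Kr_def)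
    ultimately show ?thesis using compact unfolding compactin_fip by blast
  qed
  then obtain x0 where x0: "x0 \<in> Kr" "\<And>y. y \<in> Kr \<Longrightarrow> F x0 y x0 \<notin> uminus ` interior C"
    by (auto simp: G_def)
  then have "x0 \<in> K" "norm x0 \<le> r" by (auto simp: Kr_def)
  \<comment> \<open>Coercivity supplies \<open>w\<close> if \<open>x0\<close> lies on the sphere; inside the ball \<open>x0\<close> itself will do.\<close>
  obtain w where w: "w \<in> K" "norm w < r" "F x0 w x0 \<in> uminus ` C"
    using coercive[OF \<open>x0 \<in> K\<close>] iii[OF \<open>x0 \<in> K\<close>] \<open>x0 \<in> K\<close> \<open>norm x0 \<le> r\<close>
    by (cases "norm x0 = r") force+
  have "F x0 y x0 \<notin> uminus ` interior C" if y: "y \<in> K" for y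
  proof
    assume neg: "F x0 y x0 \<in> uminus ` interior C"
    \<comment> \<open>Small enough that the point at parameter \<open>t\<close> on the segment from \<open>w\<close> to \<open>y\<close> stays in the ball.\<close>
    define t where "t = min 1 ((r - norm w) / (norm y + 1))"
    have y1: "0 < norm y + 1" by (simp add: add_nonneg_pos)
    have t: "0 < t" "t \<le> 1" using w(2) y1 by (simp_all add: t_def)
    have "t * (norm y + 1) \<le> (r - norm w) / (norm y + 1) * (norm y + 1)"
      using y1 by (intro mult_right_mono) (simp_all add: t_def)
    then have small: "t * (norm y + 1) \<le> r - norm w" using y1 by simp
    let ?z = "t *\<^sub>R y + (1 - t) *\<^sub>R w"
    have "norm ?z \<le> t * norm y + (1 - t) * norm w"
      using norm_triangle_ineq[of "t *\<^sub>R y" "(1 - t) *\<^sub>R w"] t by simp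
    also have "\<dots> \<le> r"
    proof -
      have "(1 - t) * norm w \<le> 1 * norm w" using t by (intro mult_right_mono) auto
      moreover have "t * norm y \<le> t * (norm y + 1)" using t by (intro mult_left_mono) auto
      ultimately show ?thesis using small by linarith
    qed
    finally have "?z \<in> Kr" using K(2) y w(1) t by (auto simp: Kr_def convexD)
    moreover have "F x0 ?z x0 \<in> uminus ` interior C"
      by (rule cone_convex_on_negative_combination[OF cone convex_cone ii[OF \<open>x0 \<in> K\<close>] y w(1) t neg w(3)])
    ultimately show False using x0(2) by blast
  qed
  with \<open>x0 \<in> K\<close> show ?thesis by blast
qed

end
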